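(* Let $n\ge 3$ and $d\ge 1$ be integers. For every integer $k$ with $2\le k\le\binom{n+d-1}{n-1}$ there exists a form $h$ of degree $d$ in $n$ variables $x_1,\dots,x_n$ with real coefficients such that $h$ has exactly $k$ terms, $h$ is indefinite, and $h$ is irreducible in $\mathbb C[x_1,\dots,x_n]$.
   Context: A form is a homogeneous polynomial. The number of terms of a form is the number of monomials appearing in it with nonzero coefficient. A real form is indefinite if it takes both strictly positive and strictly negative values on $\mathbb R^n$. *)

theory Defs
  imports
    "HOL-Analysis.Analysis"
    "HOL-Library.Poly_Mapping"
    "HOL-Computational_Algebra.Factorial_Ring"
begin

text \<open>The polynomial ring over \<open>'a\<close> in \<open>CARD('n)\<close> variables: a monomial is its exponent
  vector \<open>'n \<Rightarrow>\<^sub>0 nat\<close>, and a polynomial maps finitely many monomials to nonzero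
  coefficients. For finite \<open>'n\<close> this type is the whole ring \<open>'a[x\<^sub>1, ..., x\<^sub>n]\<close>, so the
  type-class predicate \<^const>\<open>irreducible\<close> refers to exactly that ring.\<close>

type_synonym ('n, 'a) multipoly = "('n \<Rightarrow>\<^sub>0 nat) \<Rightarrow>\<^sub>0 'a"

definition is_form :: "nat \<Rightarrow> ('n::finite, 'a::zero) multipoly \<Rightarrow> bool" where
  "is_form d p \<longleftrightarrow> (\<forall>m \<in> Poly_Mapping.keys p. (\<Sum>i\<in>UNIV. Poly_Mapping.lookup m i) = d)"

definition num_terms :: "('n, 'a::zero) multipoly \<Rightarrow> nat" where
  "num_terms p = card (Poly_Mapping.keys p)"

definition eval_poly :: "('n::finite, real) multipoly \<Rightarrow> real ^ 'n \<Rightarrow> real" where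
  "eval_poly p x =
    (\<Sum>m \<in> Poly_Mapping.keys p.
       Poly_Mapping.lookup p m * (\<Prod>i\<in>UNIV. (x $ i) ^ Poly_Mapping.lookup m i))"

definition indefinite :: "('n::finite, real) multipoly \<Rightarrow> bool" where
  "indefinite p \<longleftrightarrow> (\<exists>x. eval_poly p x > 0) \<and> (\<exists>y. eval_poly p y < 0)"

definition complexify :: "('n, real) multipoly \<Rightarrow> ('n, complex) multipoly" where
  "complexify p = Poly_Mapping.map complex_of_real p"

end

(* Perturb h0 = x_i x_j^(d-1) - x_l^d. Every factor of a form that is homogeneous for an additive
   weight is homogeneous for it as well, and applying this to enough weights shows that h0 is
   irreducible. Irreducibility of forms of degree d is an open condition, so adding any further
   monomials with a small coefficient t > 0 preserves it. The perturbed form is at least 1 at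
   e_i + e_j and equal to -1 at e_l, for every t > 0. *)
theory Submission imports Defs begin

section \<open>Products of polynomials and additive weights\<close>

text \<open>Allowing supersets of the supports lets the index sets stay fixed while the factors
  vary, which the limit argument for factorizations relies on.\<close>

lemma lookup_times_sum:
  fixes f g :: "'a::monoid_add \<Rightarrow>\<^sub>0 'b::semiring_0"
  assumes "finite A" "Poly_Mapping.keys f \<subseteq> A" "finite B" "Poly_Mapping.keys g \<subseteq> B"
  shows "Poly_Mapping.lookup (f * g) m =
    (\<Sum>p\<in>A. \<Sum>q\<in>B. if p + q = m then Poly_Mapping.lookup f p * Poly_Mapping.lookup g q else 0)"
proof -
  have inner: "(\<Sum>q. Poly_Mapping.lookup g q when m = p + q) =
      (\<Sum>q\<in>B. Poly_Mapping.lookup g q when m = p + q)" for p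
    by (rule Sum_any.expand_superset)
      (use assms in \<open>auto simp: in_keys_iff when_def split: if_splits\<close>)
  have "Poly_Mapping.lookup (f * g) m =
      (\<Sum>p. Poly_Mapping.lookup f p * (\<Sum>q\<in>B. Poly_Mapping.lookup g q when m = p + q))"
    by (simp add: lookup_mult inner)
  also have "\<dots> = (\<Sum>p\<in>A. Poly_Mapping.lookup f p * (\<Sum>q\<in>B. Poly_Mapping.lookup g q when m = p + q))"
    by (rule Sum_any.expand_superset)
      (use assms(1,2) in \<open>auto simp: subset_iff in_keys_iff, metis mult_zero_left\<close>)
  also have "\<dots> = (\<Sum>p\<in>A. \<Sum>q\<in>B. if p + q = m
      then Poly_Mapping.lookup f p * Poly_Mapping.lookup g q else 0)"
    unfolding sum_distrib_left
    by (intro sum.cong refl) (auto simp: when_def)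
  finally show ?thesis .
qed

text \<open>Positional notation: the exponents are read as the digits of one number, in bases chosen
  large enough for the finite set \<open>A\<close>. With \<open>I = UNIV\<close> this gives an
  additive weight that is injective on \<open>A\<close>.\<close>

lemma ex_additive_separating:
  fixes A :: "('n \<Rightarrow>\<^sub>0 nat) set"
  assumes "finite I" "finite A"
  shows "\<exists>\<phi>::('n \<Rightarrow>\<^sub>0 nat) \<Rightarrow> nat. (\<forall>p q. \<phi> (p + q) = \<phi> p + \<phi> q) \<and>
    (\<forall>p\<in>A. \<forall>q\<in>A. \<phi> p = \<phi> q \<longrightarrow> (\<forall>i\<in>I. Poly_Mapping.lookup p i = Poly_Mapping.lookup q i))"
  using assms(1)
proof (induction I rule: finite_induct)
  case empty
  show ?case by (rule exI[of _ "\<lambda>_. 0"]) auto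
next
  case (insert i I)
  then obtain \<phi> :: "('n \<Rightarrow>\<^sub>0 nat) \<Rightarrow> nat" where add: "\<And>p q. \<phi> (p + q) = \<phi> p + \<phi> q"
    and sep: "\<And>p q i. p \<in> A \<Longrightarrow> q \<in> A \<Longrightarrow> \<phi> p = \<phi> q \<Longrightarrow> i \<in> I \<Longrightarrow>
      Poly_Mapping.lookup p i = Poly_Mapping.lookup q i"
    by blast
  \<comment> \<open>The base exceeds every exponent of variable \<open>i\<close> in
    \<open>A\<close>, so \<open>mod B\<close> and \<open>div B\<close> recover the new digit and the
    old weight from \<open>\<psi>\<close>.\<close>
  define B where "B = Suc (\<Sum>p\<in>A. Poly_Mapping.lookup p i)"
  have less: "Poly_Mapping.lookup p i < B" if "p \<in> A" for p
    unfolding B_def less_Suc_eq_le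
    using \<open>finite A\<close> that by (intro member_le_sum) auto
  define \<psi> where "\<psi> p = Poly_Mapping.lookup p i + B * \<phi> p" for p
  have "\<psi> (p + q) = \<psi> p + \<psi> q" for p q
    by (simp add: \<psi>_def add lookup_add algebra_simps)
  moreover have "Poly_Mapping.lookup p k = Poly_Mapping.lookup q k"
    if "p \<in> A" "q \<in> A" "\<psi> p = \<psi> q" "k \<in> insert i I" for p q k
  proof -
    have "\<psi> p mod B = \<psi> q mod B" "\<psi> p div B = \<psi> q div B" using that by auto
    then have "Poly_Mapping.lookup p i = Poly_Mapping.lookup q i" "\<phi> p = \<phi> q"
      using less[OF that(1)] less[OF that(2)] by (auto simp: \<psi>_def)
    then show ?thesis using sep that by auto
  qed
  ultimately show ?case by blast
qed

text \<open>Refining \<open>w\<close> to an injective weight, the top monomials of both factors are unique, so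
  their product cannot cancel.\<close>
lemma top_weight_keys_mult:
  fixes f g :: "('n::finite, 'a::semiring_no_zero_divisors) multipoly"
    and w :: "('n \<Rightarrow>\<^sub>0 nat) \<Rightarrow> int"
  assumes add: "\<And>p q. w (p + q) = w p + w q" and "f \<noteq> 0" "g \<noteq> 0"
  obtains p q where "p \<in> Poly_Mapping.keys f" "q \<in> Poly_Mapping.keys g"
    "p + q \<in> Poly_Mapping.keys (f * g)"
    "\<And>p'. p' \<in> Poly_Mapping.keys f \<Longrightarrow> w p' \<le> w p"
    "\<And>q'. q' \<in> Poly_Mapping.keys g \<Longrightarrow> w q' \<le> w q"
proof -
  let ?A = "Poly_Mapping.keys f" and ?B = "Poly_Mapping.keys g"
  define C where "C = ?A \<union> ?B"
  have finC: "finite C" by (simp add: C_def)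
  obtain \<phi> :: "('n \<Rightarrow>\<^sub>0 nat) \<Rightarrow> nat" where \<phi>_add: "\<And>p q. \<phi> (p + q) = \<phi> p + \<phi> q"
    and \<phi>_inj: "\<And>p q. p \<in> C \<Longrightarrow> q \<in> C \<Longrightarrow> \<phi> p = \<phi> q \<Longrightarrow> p = q"
    using ex_additive_separating[OF finite[of UNIV] finC] by (metis UNIV_I poly_mapping_eqI)
  \<comment> \<open>\<open>N\<close> exceeds all values of \<open>\<phi>\<close> on
    \<open>C\<close>. Hence \<open>\<psi>\<close> below compares by \<open>w\<close> first and
    breaks ties by \<open>\<phi>\<close>; floor division keeps this correct for negative
    \<open>w\<close>.\<close>
  define N where "N = int (Suc (\<Sum>p\<in>C. \<phi> p))"
  have less: "int (\<phi> p) < N" if "p \<in> C" for p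
  proof -
    have "\<phi> p \<le> (\<Sum>p\<in>C. \<phi> p)" using finC that by (intro member_le_sum) auto
    then show ?thesis by (simp add: N_def del: of_nat_sum)
  qed
  define \<psi> where "\<psi> p = int (\<phi> p) + N * w p" for p
  have \<psi>_add: "\<psi> (p + q) = \<psi> p + \<psi> q" for p q
    by (simp add: \<psi>_def \<phi>_add add algebra_simps)
  have div: "\<psi> p div N = w p" "\<psi> p mod N = int (\<phi> p)" if "p \<in> C" for p
    using less[OF that] by (auto simp: \<psi>_def)
  have \<psi>_inj: "p = q" if "p \<in> C" "q \<in> C" "\<psi> p = \<psi> q" for p q
    using div(2)[OF that(1)] div(2)[OF that(2)] that \<phi>_inj by simp
  have w_mono: "w p \<le> w q" if "p \<in> C" "q \<in> C" "\<psi> p \<le> \<psi> q" for p q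
    using zdiv_mono1[OF that(3), of N] div(1)[OF that(1)] div(1)[OF that(2)]
    by (simp add: N_def sum_nonneg add_pos_nonneg)
  have max: "\<exists>p\<in>S. \<forall>p'\<in>S. \<psi> p' \<le> \<psi> p" if "finite S" "S \<noteq> {}" for S
  proof -
    have "Max (\<psi> ` S) \<in> \<psi> ` S" using that by (intro Max_in) auto
    then obtain p where "p \<in> S" "\<psi> p = Max (\<psi> ` S)" by force
    with that show ?thesis by (intro bexI[of _ p]) auto
  qed
  have ne: "?A \<noteq> {}" "?B \<noteq> {}" using assms by auto
  obtain p where p: "p \<in> ?A" "\<And>p'. p' \<in> ?A \<Longrightarrow> \<psi> p' \<le> \<psi> p"
    using max[OF finite_keys ne(1)] by blast
  obtain q where q: "q \<in> ?B" "\<And>q'. q' \<in> ?B \<Longrightarrow> \<psi> q' \<le> \<psi> q"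
    using max[OF finite_keys ne(2)] by blast
  \<comment> \<open>Two summands that are each at most maximal and whose sum is maximal must both be
    maximal. So the coefficient at \<open>p + q\<close> is a single product of nonzero
    coefficients.\<close>
  have only: "p' + q' = p + q \<longleftrightarrow> p' = p \<and> q' = q" if "p' \<in> ?A" "q' \<in> ?B" for p' q'
  proof
    assume "p' + q' = p + q"
    then have "\<psi> p' + \<psi> q' = \<psi> p + \<psi> q" by (metis \<psi>_add)
    with p(2)[OF that(1)] q(2)[OF that(2)] have "\<psi> p' = \<psi> p" "\<psi> q' = \<psi> q" by auto
    then show "p' = p \<and> q' = q" using that p q \<psi>_inj by (auto simp: C_def)
  qed auto
  have "Poly_Mapping.lookup (f * g) (p + q) = (\<Sum>p'\<in>?A. \<Sum>q'\<in>?B. if p' + q' = p + q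
      then Poly_Mapping.lookup f p' * Poly_Mapping.lookup g q' else 0)"
    by (rule lookup_times_sum) auto
  also have "\<dots> = (\<Sum>p'\<in>?A. if p' = p then (\<Sum>q'\<in>?B. if q' = q
      then Poly_Mapping.lookup f p * Poly_Mapping.lookup g q else 0) else 0)"
    by (intro sum.cong refl) (auto simp: only intro!: sum.cong)
  also have "\<dots> = Poly_Mapping.lookup f p * Poly_Mapping.lookup g q"
    using p(1) q(1) by simp
  finally have "p + q \<in> Poly_Mapping.keys (f * g)"
    using p(1) q(1) by (auto simp: in_keys_iff)
  then show ?thesis
    using that[OF p(1) q(1)] p q w_mono by (auto simp: C_def)
qed

text \<open>For the zero weight, the top monomials still supply a key of
  \<open>f * g\<close>.\<close>

lemma multipoly_mult_nonzero:
  fixes f g :: "('n::finite, 'a::semiring_no_zero_divisors) multipoly"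
  assumes "f \<noteq> 0" "g \<noteq> 0"
  shows "f * g \<noteq> 0"
  by (rule top_weight_keys_mult[of "\<lambda>_. 0" f g]) (use assms in auto)

text \<open>Top weights of the factors add up, and so do bottom weights, by applying the previous
  result to \<open>w\<close> and to its negative. For the product top and bottom agree, which forces
  them to agree in each factor.\<close>

lemma weighted_homogeneous_factors:
  fixes f g :: "('n::finite, 'a::semiring_no_zero_divisors) multipoly"
    and w :: "('n \<Rightarrow>\<^sub>0 nat) \<Rightarrow> nat"
  assumes add: "\<And>p q. w (p + q) = w p + w q" and nz: "f * g \<noteq> 0"
    and hom: "\<And>m. m \<in> Poly_Mapping.keys (f * g) \<Longrightarrow> w m = d"
  obtains a b where "a + b = d"
    "\<And>m. m \<in> Poly_Mapping.keys f \<Longrightarrow> w m = a"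
    "\<And>m. m \<in> Poly_Mapping.keys g \<Longrightarrow> w m = b"
proof -
  have nz': "f \<noteq> 0" "g \<noteq> 0" using nz by auto
  obtain p q where pq: "p \<in> Poly_Mapping.keys f" "q \<in> Poly_Mapping.keys g"
    "p + q \<in> Poly_Mapping.keys (f * g)"
    "\<And>p'. p' \<in> Poly_Mapping.keys f \<Longrightarrow> int (w p') \<le> int (w p)"
    "\<And>q'. q' \<in> Poly_Mapping.keys g \<Longrightarrow> int (w q') \<le> int (w q)"
    by (rule top_weight_keys_mult[of "\<lambda>p. int (w p)", OF _ nz']) (auto simp: add)
  obtain r s where rs: "r \<in> Poly_Mapping.keys f" "s \<in> Poly_Mapping.keys g"
    "r + s \<in> Poly_Mapping.keys (f * g)"
    "\<And>p'. p' \<in> Poly_Mapping.keys f \<Longrightarrow> - int (w p') \<le> - int (w r)"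
    "\<And>q'. q' \<in> Poly_Mapping.keys g \<Longrightarrow> - int (w q') \<le> - int (w s)"
    by (rule top_weight_keys_mult[of "\<lambda>p. - int (w p)", OF _ nz']) (auto simp: add)
  have d: "w p + w q = d" "w r + w s = d"
    using hom[OF pq(3)] hom[OF rs(3)] by (auto simp: add)
  have "w r = w p" "w s = w q"
    using d pq(4)[OF rs(1)] pq(5)[OF rs(2)] by auto
  then show ?thesis
    using that[OF d(1)] pq(4,5) rs(4,5) by (metis le_antisym neg_le_iff_le of_nat_le_iff)
qed

section \<open>Units and factors of forms\<close>

lemma const_dvd_one:
  fixes f :: "('n, 'a::field) multipoly"
  assumes "f \<noteq> 0" "Poly_Mapping.keys f \<subseteq> {0}"
  shows "f dvd 1"
proof -
  define c where "c = Poly_Mapping.lookup f 0"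
  have f: "f = Poly_Mapping.single 0 c"
    using assms(2) by (intro poly_mapping_eqI) (auto simp: c_def lookup_single when_def in_keys_iff)
  with assms have "c \<noteq> 0" by auto
  then have "f * Poly_Mapping.single 0 (inverse c) = 1" by (simp add: f mult_single)
  then show ?thesis by (metis dvdI)
qed

text \<open>Total degree is an additive weight and \<open>1\<close> has weight 0, so both factors of
  \<open>1\<close> have weight 0.\<close>

lemma degree_zero_if_dvd_one:
  fixes f :: "('n::finite, 'a::field) multipoly"
  assumes "f dvd 1" "is_form a f"
  shows "a = 0"
proof -
  obtain g where g: "f * g = 1" using assms(1) by (metis dvdE)
  then have "f \<noteq> 0" by auto
  obtain a' b where ab: "a' + b = (0::nat)"
    "\<And>m. m \<in> Poly_Mapping.keys f \<Longrightarrow> (\<Sum>i\<in>UNIV. Poly_Mapping.lookup m i) = a'"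
    by (rule weighted_homogeneous_factors[of "\<lambda>m. \<Sum>i\<in>UNIV. Poly_Mapping.lookup m i" f g 0])
      (auto simp: lookup_add sum.distrib g)
  obtain m where m: "m \<in> Poly_Mapping.keys f"
    using \<open>f \<noteq> 0\<close> by (metis all_not_in_conv keys_eq_empty)
  show ?thesis using ab(1) ab(2)[OF m] bspec[OF assms(2)[unfolded is_form_def] m] by linarith
qed

lemma form_factors:
  fixes f g :: "('n::finite, 'a::semiring_no_zero_divisors) multipoly"
  assumes "is_form d (f * g)" "f * g \<noteq> 0"
  obtains a b where "a + b = d" "is_form a f" "is_form b g"
  by (rule weighted_homogeneous_factors[of "\<lambda>m. \<Sum>i\<in>UNIV. Poly_Mapping.lookup m i" f g d])
    (use assms in \<open>auto simp: lookup_add sum.distrib is_form_def\<close>)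

lemma form_zero_dvd_one:
  fixes f :: "('n::finite, 'a::field) multipoly"
  assumes "is_form 0 f" "f \<noteq> 0"
  shows "f dvd 1"
proof (rule const_dvd_one[OF assms(2)])
  show "Poly_Mapping.keys f \<subseteq> {0}"
    using assms(1) by (auto simp: is_form_def intro!: poly_mapping_eqI)
qed

section \<open>Factors of the binomial\<close>

lemma sum_lookup_single:
  "(\<Sum>i\<in>UNIV. Poly_Mapping.lookup (Poly_Mapping.single (j::'n::finite) (e::nat)) i) = e"
  by (simp add: lookup_single when_def)

text \<open>Both monomials of the product agree in three kinds of weight: the exponent of any
  variable other than \<open>i\<close>, \<open>j\<close>, \<open>l\<close>; \<open>d\<close> times
  the exponent of \<open>i\<close> plus that of \<open>l\<close>; and the total degree. With the
  exponent of \<open>i\<close> zero on \<open>f\<close>, these determine all exponents, so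
  \<open>f\<close> has a single monomial. It divides two monomials without a common variable and is
  therefore constant.\<close>

lemma binomial_factor_free_var:
  fixes f g :: "('n::finite, 'a::field) multipoly"
  assumes d: "d \<ge> 1" and dist: "i \<noteq> j" "i \<noteq> l" "j \<noteq> l"
    and keys: "Poly_Mapping.keys (f * g) =
      {Poly_Mapping.single i 1 + Poly_Mapping.single j (d - 1), Poly_Mapping.single l d}"
    and free: "\<And>m. m \<in> Poly_Mapping.keys f \<Longrightarrow> Poly_Mapping.lookup m i = 0"
  shows "f dvd 1"
proof -
  have nz: "f * g \<noteq> 0" using keys by auto
  then have "f \<noteq> 0" by auto
  obtain m0 where m0: "m0 \<in> Poly_Mapping.keys f"
    using \<open>f \<noteq> 0\<close> by (metis all_not_in_conv keys_eq_empty)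
  have other: "Poly_Mapping.lookup m k = Poly_Mapping.lookup m0 k"
    if "k \<noteq> i" "k \<noteq> j" "k \<noteq> l" "m \<in> Poly_Mapping.keys f" for m k
    by (rule weighted_homogeneous_factors[of "\<lambda>m. Poly_Mapping.lookup m k" f g 0])
      (use that nz m0 in \<open>auto simp: lookup_add keys lookup_single\<close>)
  have l: "Poly_Mapping.lookup m l = Poly_Mapping.lookup m0 l" if "m \<in> Poly_Mapping.keys f" for m
    by (rule weighted_homogeneous_factors[of
          "\<lambda>m. d * Poly_Mapping.lookup m i + Poly_Mapping.lookup m l" f g d])
      (use that nz m0 free dist in \<open>auto simp: lookup_add keys lookup_single algebra_simps\<close>)
  have total: "(\<Sum>k\<in>UNIV. Poly_Mapping.lookup m k) = (\<Sum>k\<in>UNIV. Poly_Mapping.lookup m0 k)"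
    if "m \<in> Poly_Mapping.keys f" for m
    by (rule weighted_homogeneous_factors[of "\<lambda>m. \<Sum>k\<in>UNIV. Poly_Mapping.lookup m k" f g d])
      (use that nz m0 d in \<open>auto simp: lookup_add keys sum.distrib sum_lookup_single\<close>)
  have "m = m0" if m: "m \<in> Poly_Mapping.keys f" for m
  proof -
    have rest: "Poly_Mapping.lookup m k = Poly_Mapping.lookup m0 k" if "k \<noteq> j" for k
      using that other[of k m] l[OF m] m free[OF m] free[OF m0] by (metis (full_types))
    have "(\<Sum>k\<in>UNIV - {j}. Poly_Mapping.lookup m k) = (\<Sum>k\<in>UNIV - {j}. Poly_Mapping.lookup m0 k)"
      by (intro sum.cong) (auto simp: rest)
    then have "Poly_Mapping.lookup m j = Poly_Mapping.lookup m0 j"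
      using total[OF m] by (simp add: sum.remove[of UNIV j])
    with rest show ?thesis by (intro poly_mapping_eqI) metis
  qed
  then have single: "Poly_Mapping.keys f \<subseteq> {m0}" by auto
  \<comment> \<open>Every monomial of \<open>f * g\<close> is \<open>m0\<close> plus a monomial of
    \<open>g\<close>.\<close>
  have div: "Poly_Mapping.lookup m0 k \<le> Poly_Mapping.lookup m k"
    if "m \<in> Poly_Mapping.keys (f * g)" for m k
    using subsetD[OF keys_mult that] single by (auto simp: lookup_add)
  have "Poly_Mapping.lookup m0 k \<le> 0" for k
    using div[of "Poly_Mapping.single i 1 + Poly_Mapping.single j (d - 1)" k]
      div[of "Poly_Mapping.single l d" k] dist
    by (cases "k = l") (auto simp: keys lookup_add lookup_single when_def)
  then have "m0 = 0" by (intro poly_mapping_eqI) auto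
  with single show ?thesis by (intro const_dvd_one[OF \<open>f \<noteq> 0\<close>]) auto
qed

text \<open>The product has weight \<open>d\<close> under \<open>?w\<close>. A factor involving
  variable \<open>i\<close> has weight at least \<open>d\<close>, so at most one factor involves it,
  and the other is a unit by the previous lemma.\<close>

lemma binomial_factor_dvd_one:
  fixes f g :: "('n::finite, 'a::field) multipoly"
  assumes d: "d \<ge> 1" and dist: "i \<noteq> j" "i \<noteq> l" "j \<noteq> l"
    and keys: "Poly_Mapping.keys (f * g) =
      {Poly_Mapping.single i 1 + Poly_Mapping.single j (d - 1), Poly_Mapping.single l d}"
  shows "f dvd 1 \<or> g dvd 1"
proof -
  let ?w = "\<lambda>m. d * Poly_Mapping.lookup m i + Poly_Mapping.lookup m l"
  have nz: "f * g \<noteq> 0" using keys by auto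
  obtain a b where ab: "a + b = d" "\<And>m. m \<in> Poly_Mapping.keys f \<Longrightarrow> ?w m = a"
    "\<And>m. m \<in> Poly_Mapping.keys g \<Longrightarrow> ?w m = b"
    by (rule weighted_homogeneous_factors[of ?w f g d])
      (use nz dist in \<open>auto simp: lookup_add keys lookup_single algebra_simps\<close>)
  have "(\<forall>m\<in>Poly_Mapping.keys f. Poly_Mapping.lookup m i = 0) \<or>
        (\<forall>m\<in>Poly_Mapping.keys g. Poly_Mapping.lookup m i = 0)"
  proof (rule ccontr)
    assume "\<not> ?thesis"
    then obtain m m' where m: "m \<in> Poly_Mapping.keys f" "Poly_Mapping.lookup m i > 0"
      "m' \<in> Poly_Mapping.keys g" "Poly_Mapping.lookup m' i > 0" by auto
    then have "d * 1 \<le> d * Poly_Mapping.lookup m i" "d * 1 \<le> d * Poly_Mapping.lookup m' i"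
      by (intro mult_le_mono; simp)+
    with ab(1) ab(2)[OF m(1)] ab(3)[OF m(3)] d show False by simp
  qed
  then show ?thesis
    using binomial_factor_free_var[OF d dist keys]
      binomial_factor_free_var[OF d dist, of g f] keys by (auto simp: mult.commute)
qed

section \<open>Counting monomials of given degree\<close>

definition monomials_of_degree :: "nat \<Rightarrow> ('n::finite \<Rightarrow>\<^sub>0 nat) set" where
  "monomials_of_degree d = {m. (\<Sum>i\<in>UNIV. Poly_Mapping.lookup m i) = d}"

text \<open>Stars and bars: along an enumeration \<open>e\<close> of the variables, monomials become
  the lists of length \<open>n\<close> with sum \<open>d\<close>, which
  \<open>card_length_sum_list\<close> counts.\<close>

lemma card_monomials_of_degree:
  "card (monomials_of_degree d :: ('n::finite \<Rightarrow>\<^sub>0 nat) set) =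
    (CARD('n) + d - 1) choose (CARD('n) - 1)" (is "card ?M = _")
proof -
  define n where "n = CARD('n)"
  have n: "n \<ge> 1" by (simp add: n_def Suc_leI)
  obtain e where e: "bij_betw e {0..<n} (UNIV :: 'n set)"
    using ex_bij_betw_nat_finite[of "UNIV :: 'n set"] by (auto simp: n_def)
  let ?L = "{l::nat list. length l = n \<and> sum_list l = d}"
  define F where "F m = map (\<lambda>k. Poly_Mapping.lookup m (e k)) [0..<n]" for m :: "'n \<Rightarrow>\<^sub>0 nat"
  have sum: "sum_list (F m) = (\<Sum>i\<in>UNIV. Poly_Mapping.lookup m i)" for m
    using sum.reindex_bij_betw[OF e, of "Poly_Mapping.lookup m"]
    by (simp add: F_def interv_sum_list_conv_sum_set_nat)
  have surj: "\<exists>k<n. i = e k" for i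
    using e unfolding bij_betw_def by (metis UNIV_I atLeastLessThan_iff image_iff)
  have "bij_betw F ?M ?L"
  proof (rule bij_betw_imageI)
    show "inj_on F ?M"
    proof (rule inj_onI, rule poly_mapping_eqI)
      fix m m' :: "'n \<Rightarrow>\<^sub>0 nat" and i assume "F m = F m'"
      then show "Poly_Mapping.lookup m i = Poly_Mapping.lookup m' i"
        using surj[of i] by (auto simp: F_def)
    qed
    show "F ` ?M = ?L"
    proof (intro equalityI subsetI)
      fix l assume l: "l \<in> ?L"
      define m where "m = Abs_poly_mapping (\<lambda>i. l ! inv_into {0..<n} e i)"
      have m: "Poly_Mapping.lookup m (e k) = l ! k" if "k < n" for k
        using e that by (simp add: m_def bij_betw_def)
      have "F m = l" using l m by (auto simp: F_def intro!: nth_equalityI)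
      with l sum[of m] show "l \<in> F ` ?M"
        by (intro image_eqI[of _ _ m]) (auto simp: monomials_of_degree_def)
    qed (auto simp: monomials_of_degree_def F_def simp flip: sum)
  qed
  then have "card ?M = (d + n - 1) choose d"
    by (simp add: bij_betw_same_card card_length_sum_list)
  also have "\<dots> = (d + n - 1) choose (n - 1)"
    using n by (subst binomial_symmetric) auto
  finally show ?thesis by (simp add: n_def add.commute)
qed

text \<open>Since \<open>card\<close> is 0 on infinite sets, positivity of the binomial coefficient
  already yields finiteness.\<close>

lemma finite_monomials_of_degree: "finite (monomials_of_degree d :: ('n::finite \<Rightarrow>\<^sub>0 nat) set)"
proof (rule card_ge_0_finite)
  have "CARD('n) \<ge> 1" by (simp add: Suc_leI)
  then show "card (monomials_of_degree d :: ('n \<Rightarrow>\<^sub>0 nat) set) > 0"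
    unfolding card_monomials_of_degree by (subst zero_less_binomial_iff) auto
qed

section \<open>Limits of factored forms\<close>

text \<open>Bolzano-Weierstrass one index at a time: each new index passes to a further subsequence,
  which preserves the limits already obtained.\<close>

lemma bounded_family_convergent_subsequence:
  fixes F :: "nat \<Rightarrow> 'm \<Rightarrow> 'b::heine_borel"
  assumes "finite M" "\<And>m. m \<in> M \<Longrightarrow> bounded (range (\<lambda>j. F j m))"
  shows "\<exists>r l. strict_mono (r :: nat \<Rightarrow> nat) \<and> (\<forall>m\<in>M. (\<lambda>j. F (r j) m) \<longlonglongrightarrow> l m)"
  using assms
proof (induction M rule: finite_induct)
  case empty
  show ?case by (rule exI[of _ id]) (auto simp: strict_mono_def)
next
  case (insert x M)
  then obtain r l where r: "strict_mono r" "\<And>m. m \<in> M \<Longrightarrow> (\<lambda>j. F (r j) m) \<longlonglongrightarrow> l m"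
    by auto
  have "bounded (range (\<lambda>j. F (r j) x))"
    by (rule bounded_subset[OF insert.prems[of x]]) auto
  then obtain y s where s: "strict_mono s" "((\<lambda>j. F (r j) x) \<circ> s) \<longlonglongrightarrow> y"
    using bounded_imp_convergent_subsequence by blast
  have "(\<lambda>j. F ((r \<circ> s) j) m) \<longlonglongrightarrow> (l(x := y)) m" if "m \<in> insert x M" for m
    using s(2) LIMSEQ_subseq_LIMSEQ[OF r(2) s(1), of m] that by (auto simp: o_def)
  with strict_mono_o[OF r(1) s(1)] show ?case by blast
qed

lemma is_form_iff_keys: "is_form d f \<longleftrightarrow> Poly_Mapping.keys f \<subseteq> monomials_of_degree d"
  by (auto simp: is_form_def monomials_of_degree_def)

text \<open>The cutoff outside \<open>T\<close> gives finite support for finite \<open>T\<close>, so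
  that \<open>Abs_poly_mapping\<close> is meaningful for arbitrary \<open>c\<close>, such as a
  family of limits.\<close>

definition poly_on :: "'m set \<Rightarrow> ('m \<Rightarrow> 'b::zero) \<Rightarrow> 'm \<Rightarrow>\<^sub>0 'b" where
  "poly_on T c = Abs_poly_mapping (\<lambda>m. if m \<in> T then c m else 0)"

lemma lookup_poly_on:
  "finite T \<Longrightarrow> Poly_Mapping.lookup (poly_on T c) m = (if m \<in> T then c m else 0)"
  unfolding poly_on_def by (subst lookup_Abs_poly_mapping) (auto elim: rev_finite_subset)

lemma keys_poly_on: "finite T \<Longrightarrow> Poly_Mapping.keys (poly_on T c) = {m \<in> T. c m \<noteq> 0}"
  by (auto simp: in_keys_iff lookup_poly_on split: if_splits)

lemma lookup_times_forms:
  fixes f g :: "('n::finite, 'a::semiring_0) multipoly"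
  assumes "is_form a f" "is_form b g"
  shows "Poly_Mapping.lookup (f * g) m =
    (\<Sum>p\<in>monomials_of_degree a. \<Sum>q\<in>monomials_of_degree b.
      if p + q = m then Poly_Mapping.lookup f p * Poly_Mapping.lookup g q else 0)"
  using assms by (intro lookup_times_sum) (auto simp: is_form_iff_keys finite_monomials_of_degree)

text \<open>Compactness: once both factors are scaled to have coefficient norm 1, a subsequence of the
  pairs of factors converges to nonzero forms, whose product is a nonzero multiple of \<open>h0\<close>.\<close>
lemma form_product_limit:
  fixes h :: "nat \<Rightarrow> ('n::finite, 'a::{real_normed_field,heine_borel}) multipoly"
  assumes conv: "\<And>m. (\<lambda>j. Poly_Mapping.lookup (h j) m) \<longlonglongrightarrow> Poly_Mapping.lookup h0 m"
    and nz: "h0 \<noteq> 0" "\<And>j. h j \<noteq> 0"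
    and fac: "\<And>j. \<exists>f g. is_form a f \<and> is_form b g \<and> h j = f * g"
  shows "\<exists>f g. is_form a f \<and> is_form b g \<and> h0 = f * g"
proof -
  obtain f g where fg: "\<And>j. is_form a (f j)" "\<And>j. is_form b (g j)" "\<And>j. h j = f j * g j"
    using fac by metis
  define A :: "('n \<Rightarrow>\<^sub>0 nat) set" where "A = monomials_of_degree a"
  define B :: "('n \<Rightarrow>\<^sub>0 nat) set" where "B = monomials_of_degree b"
  have fin [simp]: "finite A" "finite B" by (simp_all add: A_def B_def finite_monomials_of_degree)
  define \<alpha> where "\<alpha> j = (\<Sum>m\<in>A. norm (Poly_Mapping.lookup (f j) m))" for j
  define \<beta> where "\<beta> j = (\<Sum>m\<in>B. norm (Poly_Mapping.lookup (g j) m))" for j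
  have zero_outside: "Poly_Mapping.lookup p m = 0" if "is_form e p" "m \<notin> monomials_of_degree e"
    for p :: "('n, 'a) multipoly" and e m
    using that by (auto simp: is_form_iff_keys in_keys_iff)
  have norm_pos: "(\<Sum>m\<in>monomials_of_degree e. norm (Poly_Mapping.lookup p m)) > 0"
    if p: "is_form e p" "p \<noteq> 0" for p :: "('n, 'a) multipoly" and e
  proof -
    obtain m where "m \<in> Poly_Mapping.keys p"
      using p(2) by (metis all_not_in_conv keys_eq_empty)
    then show ?thesis
      using p(1) by (intro sum_pos2[of _ m])
        (auto simp: is_form_iff_keys in_keys_iff finite_monomials_of_degree)
  qed
  have "f j \<noteq> 0" "g j \<noteq> 0" for j using nz(2)[of j] fg(3)[of j] by auto
  then have pos: "\<alpha> j > 0" "\<beta> j > 0" for j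
    using norm_pos fg by (auto simp: \<alpha>_def \<beta>_def A_def B_def)
  define F where "F j m = Poly_Mapping.lookup (f j) m / of_real (\<alpha> j)" for j m
  define G where "G j m = Poly_Mapping.lookup (g j) m / of_real (\<beta> j)" for j m
  have F_sum: "(\<Sum>m\<in>A. norm (F j m)) = 1" for j
  proof -
    have "(\<Sum>m\<in>A. norm (F j m)) = (\<Sum>m\<in>A. norm (Poly_Mapping.lookup (f j) m) / \<alpha> j)"
      using pos(1)[of j] by (simp add: F_def norm_divide)
    also have "\<dots> = \<alpha> j / \<alpha> j" unfolding \<alpha>_def sum_divide_distrib ..
    finally show ?thesis using pos(1)[of j] by simp
  qed
  have G_sum: "(\<Sum>m\<in>B. norm (G j m)) = 1" for j
  proof -
    have "(\<Sum>m\<in>B. norm (G j m)) = (\<Sum>m\<in>B. norm (Poly_Mapping.lookup (g j) m) / \<beta> j)"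
      using pos(2)[of j] by (simp add: G_def norm_divide)
    also have "\<dots> = \<beta> j / \<beta> j" unfolding \<beta>_def sum_divide_distrib ..
    finally show ?thesis using pos(2)[of j] by simp
  qed
  have F_le: "norm (F j m) \<le> 1" for j m
  proof (cases "m \<in> A")
    case True
    then have "norm (F j m) \<le> (\<Sum>m\<in>A. norm (F j m))" by (intro member_le_sum) auto
    then show ?thesis by (simp add: F_sum)
  qed (use zero_outside[OF fg(1)] in \<open>auto simp: F_def A_def\<close>)
  have G_le: "norm (G j m) \<le> 1" for j m
  proof (cases "m \<in> B")
    case True
    then have "norm (G j m) \<le> (\<Sum>m\<in>B. norm (G j m))" by (intro member_le_sum) auto
    then show ?thesis by (simp add: G_sum)
  qed (use zero_outside[OF fg(2)] in \<open>auto simp: G_def B_def\<close>)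
  \<comment> \<open>Pairing the coefficients makes one subsequence serve both factors.\<close>
  have "bounded (range (\<lambda>j. (F j m, G j m)))" for m
  proof (rule boundedI)
    fix z assume "z \<in> range (\<lambda>j. (F j m, G j m))"
    then obtain j where "z = (F j m, G j m)" by auto
    then show "norm z \<le> 2"
      using norm_Pair_le[of "F j m" "G j m"] F_le[of j m] G_le[of j m] by simp
  qed
  then obtain r l where r: "strict_mono (r :: nat \<Rightarrow> nat)"
    and l: "\<And>m. m \<in> A \<union> B \<Longrightarrow> (\<lambda>j. (F (r j) m, G (r j) m)) \<longlonglongrightarrow> l m"
    using bounded_family_convergent_subsequence[of "A \<union> B" "\<lambda>j m. (F j m, G j m)"] by auto
  define lf where "lf m = fst (l m)" for m
  define lg where "lg m = snd (l m)" for m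
  have F_lim: "(\<lambda>j. F (r j) m) \<longlonglongrightarrow> lf m" if "m \<in> A" for m
    using tendsto_fst[OF l[of m]] that by (simp add: lf_def)
  have G_lim: "(\<lambda>j. G (r j) m) \<longlonglongrightarrow> lg m" if "m \<in> B" for m
    using tendsto_snd[OF l[of m]] that by (simp add: lg_def)
  have "(\<lambda>j. \<Sum>m\<in>A. norm (F (r j) m)) \<longlonglongrightarrow> (\<Sum>m\<in>A. norm (lf m))"
    by (intro tendsto_sum tendsto_norm F_lim)
  then have lf_sum: "(\<Sum>m\<in>A. norm (lf m)) = 1"
    by (simp add: F_sum LIMSEQ_const_iff)
  have "(\<lambda>j. \<Sum>m\<in>B. norm (G (r j) m)) \<longlonglongrightarrow> (\<Sum>m\<in>B. norm (lg m))"
    by (intro tendsto_sum tendsto_norm G_lim)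
  then have lg_sum: "(\<Sum>m\<in>B. norm (lg m)) = 1"
    by (simp add: G_sum LIMSEQ_const_iff)
  define S where "S m = (\<Sum>p\<in>A. \<Sum>q\<in>B. if p + q = m then lf p * lg q else 0)" for m
  define c :: "nat \<Rightarrow> 'a" where "c j = 1 / (of_real (\<alpha> j) * of_real (\<beta> j))" for j
  have scaled: "Poly_Mapping.lookup (h j) m * c j =
      (\<Sum>p\<in>A. \<Sum>q\<in>B. if p + q = m then F j p * G j q else 0)" for j m
    unfolding fg(3) lookup_times_forms[OF fg(1,2)] A_def[symmetric] B_def[symmetric]
      sum_distrib_right
    by (intro sum.cong refl) (simp add: F_def G_def c_def)
  have lim: "(\<lambda>j. Poly_Mapping.lookup (h (r j)) m * c (r j)) \<longlonglongrightarrow> S m" for m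
  proof -
    have "(\<lambda>j. if p + q = m then F (r j) p * G (r j) q else 0) \<longlonglongrightarrow>
        (if p + q = m then lf p * lg q else 0)" if "p \<in> A" "q \<in> B" for p q
      using tendsto_mult[OF F_lim[OF that(1)] G_lim[OF that(2)]] by auto
    then show ?thesis unfolding scaled S_def by (intro tendsto_sum)
  qed
  have conv': "(\<lambda>j. Poly_Mapping.lookup (h (r j)) m) \<longlonglongrightarrow> Poly_Mapping.lookup h0 m" for m
    using LIMSEQ_subseq_LIMSEQ[OF conv r, of m] by (simp add: o_def)
  \<comment> \<open>Convergence of the scale factors \<open>c\<close> is not known beforehand; it is
    read off at one coefficient where \<open>h0\<close> does not vanish.\<close>
  obtain m1 where m1: "Poly_Mapping.lookup h0 m1 \<noteq> 0"
    using nz(1) by (metis poly_mapping_eqI lookup_zero)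
  define C where "C = S m1 / Poly_Mapping.lookup h0 m1"
  have c_lim: "(\<lambda>j. c (r j)) \<longlonglongrightarrow> C"
  proof (rule Lim_transform_eventually)
    show "(\<lambda>j. Poly_Mapping.lookup (h (r j)) m1 * c (r j) / Poly_Mapping.lookup (h (r j)) m1)
        \<longlonglongrightarrow> C"
      unfolding C_def by (intro tendsto_divide lim conv' m1)
    \<comment> \<open>The denominator may vanish for small \<open>j\<close>, but not eventually, its
      limit being nonzero.\<close>
    show "\<forall>\<^sub>F j in sequentially. Poly_Mapping.lookup (h (r j)) m1 * c (r j) /
        Poly_Mapping.lookup (h (r j)) m1 = c (r j)"
      using tendsto_imp_eventually_ne[OF conv' m1] by eventually_elim simp
  qed
  have S: "S m = Poly_Mapping.lookup h0 m * C" for m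
    by (rule LIMSEQ_unique[OF lim]) (intro tendsto_mult conv' c_lim)
  have form_A: "is_form a (poly_on A u)" and form_B: "is_form b (poly_on B u)"
    for u :: "('n \<Rightarrow>\<^sub>0 nat) \<Rightarrow> 'a"
    by (auto simp: is_form_iff_keys keys_poly_on A_def[symmetric] B_def[symmetric])
  have nonzero: "poly_on T u \<noteq> 0" if "finite T" "(\<Sum>m\<in>T. norm (u m)) = 1"
    for T and u :: "('n \<Rightarrow>\<^sub>0 nat) \<Rightarrow> 'a"
  proof
    assume "poly_on T u = 0"
    then have "u m = 0" if "m \<in> T" for m
      using lookup_poly_on[OF \<open>finite T\<close>, of u m] that by simp
    with that(2) show False by simp
  qed
  have prod: "Poly_Mapping.lookup (poly_on A u * poly_on B lg) m =
      (\<Sum>p\<in>A. \<Sum>q\<in>B. if p + q = m then u p * lg q else 0)" for u m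
    unfolding lookup_times_forms[OF form_A form_B] A_def[symmetric] B_def[symmetric]
    by (intro sum.cong refl) (simp add: lookup_poly_on)
  have "poly_on A lf * poly_on B lg \<noteq> 0"
    by (intro multipoly_mult_nonzero nonzero lf_sum lg_sum fin)
  then obtain m where "Poly_Mapping.lookup (poly_on A lf * poly_on B lg) m \<noteq> 0"
    by (metis poly_mapping_eqI lookup_zero)
  \<comment> \<open>With \<open>C = 0\<close> the product of the two nonzero limits would vanish.
    Being nonzero, \<open>C\<close> can be divided out of the first factor.\<close>
  then have "C \<noteq> 0" using S[of m] by (auto simp: prod S_def)
  have "h0 = poly_on A (\<lambda>m. lf m / C) * poly_on B lg"
  proof (rule poly_mapping_eqI)
    fix m
    have "Poly_Mapping.lookup (poly_on A (\<lambda>m. lf m / C) * poly_on B lg) m = S m / C"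
      unfolding prod S_def sum_divide_distrib by (intro sum.cong refl) simp
    then show "Poly_Mapping.lookup h0 m =
        Poly_Mapping.lookup (poly_on A (\<lambda>m. lf m / C) * poly_on B lg) m"
      using \<open>C \<noteq> 0\<close> by (simp add: S)
  qed
  with form_A form_B show ?thesis by blast
qed

section \<open>Irreducibility under small perturbations\<close>

text \<open>Factors of a form are forms, and a nonunit factor cannot have degree 0. The degree
  \<open>a\<close> ranges over a finite set, which prepares a pigeonhole argument.\<close>

lemma reducible_form_factors:
  fixes h :: "('n::finite, 'a::field) multipoly"
  assumes "is_form d h" "h \<noteq> 0" "d \<ge> 1" "\<not> irreducible h"
  obtains a f g where "a \<in> {1..<d}" "is_form a f" "is_form (d - a) g" "h = f * g"
proof -
  have "\<not> h dvd 1" using degree_zero_if_dvd_one assms by fastforce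
  with assms obtain f g where fg: "h = f * g" "\<not> f dvd 1" "\<not> g dvd 1"
    by (auto simp: irreducible_def)
  then have nz: "f \<noteq> 0" "g \<noteq> 0" using assms(2) by auto
  obtain a b where ab: "a + b = d" "is_form a f" "is_form b g"
    using form_factors[of d f g] assms(1,2) fg(1) by blast
  have "a \<noteq> 0" "b \<noteq> 0"
    using form_zero_dvd_one nz fg(2,3) ab(2,3) by metis+
  then show ?thesis using that[of a f g] ab fg(1) by auto
qed

text \<open>Otherwise \<open>h t\<close> factors properly along a sequence of positive
  \<open>t\<close> tending to 0, and a limit of these factorizations would split the binomial
  \<open>h 0\<close> into two forms of positive degree.\<close>

lemma ex_irreducible_perturbation:
  fixes h :: "real \<Rightarrow> ('n::finite, 'a::{real_normed_field,heine_borel}) multipoly"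
  assumes d: "d \<ge> 1" and dist: "i \<noteq> j" "i \<noteq> l" "j \<noteq> l"
    and form: "\<And>t. is_form d (h t)" and nz: "\<And>t. h t \<noteq> 0"
    and cont: "\<And>m. ((\<lambda>t. Poly_Mapping.lookup (h t) m) \<longlongrightarrow> Poly_Mapping.lookup (h 0) m) (at_right 0)"
    and keys: "Poly_Mapping.keys (h 0) =
      {Poly_Mapping.single i 1 + Poly_Mapping.single j (d - 1), Poly_Mapping.single l d}"
  shows "\<exists>t>0. irreducible (h t)"
proof (rule ccontr)
  assume "\<not> ?thesis"
  then have red: "\<not> irreducible (h t)" if "t > 0" for t using that by blast
  define s where "s n = inverse (real (Suc n))" for n
  have s: "filterlim s (at_right 0) sequentially"
    unfolding filterlim_at using LIMSEQ_inverse_real_of_nat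
    by (auto simp: s_def[abs_def] simp del: of_nat_Suc)
  have "\<exists>a\<in>{1..<d}. \<exists>f g. is_form a f \<and> is_form (d - a) g \<and> h (s n) = f * g" for n
    proof -
    have "s n > 0" by (simp add: s_def)
    from reducible_form_factors[OF form nz d red[OF this]] show ?thesis by metis
  qed
  then obtain a where a: "\<And>n. a n \<in> {1..<d}"
    "\<And>n. \<exists>f g. is_form (a n) f \<and> is_form (d - a n) g \<and> h (s n) = f * g" by metis
  \<comment> \<open>Pigeonhole: some degree \<open>a n0\<close> recurs infinitely often, so along a
    subsequence both factors have fixed degrees.\<close>
  have "finite (range a)" by (rule finite_subset[of _ "{1..<d}"]) (use a in auto)
  then obtain n0 where "infinite {n. a n = a n0}"
    using pigeonhole_infinite[of UNIV a] by auto
  then obtain r :: "nat \<Rightarrow> nat" where r: "strict_mono r" "\<And>n. a (r n) = a n0"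
    using infinite_enumerate[of "{n. a n = a n0}"] by auto
  have "\<exists>f g. is_form (a n0) f \<and> is_form (d - a n0) g \<and> h 0 = f * g"
  proof (rule form_product_limit)
    show "(\<lambda>n. Poly_Mapping.lookup (h (s (r n))) m) \<longlonglongrightarrow> Poly_Mapping.lookup (h 0) m" for m
      using filterlim_compose[OF filterlim_compose[OF cont s] filterlim_subseq[OF r(1)]] .
    show "\<exists>f g. is_form (a n0) f \<and> is_form (d - a n0) g \<and> h (s (r n)) = f * g" for n
      using a(2)[of "r n"] r(2)[of n] by simp
  qed (rule nz)+
  then obtain f g where fg: "is_form (a n0) f" "is_form (d - a n0) g" "h 0 = f * g" by blast
  have "f dvd 1 \<or> g dvd 1"
    using binomial_factor_dvd_one[OF d dist, of f g] keys fg(3) by simp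
  \<comment> \<open>A form dividing \<open>1\<close> has degree 0, but \<open>a n0\<close> and
    \<open>d - a n0\<close> are both positive.\<close>
  then show False
    using degree_zero_if_dvd_one fg(1,2) a(1)[of n0] by fastforce
qed

section \<open>The indefinite form with \<open>k\<close> terms\<close>

lemma form_monomial_eq_single:
  assumes "m \<in> monomials_of_degree d" "\<And>v. v \<noteq> l \<Longrightarrow> Poly_Mapping.lookup m v = 0"
  shows "m = Poly_Mapping.single l d"
proof (rule poly_mapping_eqI)
  fix v
  have "(\<Sum>v\<in>UNIV. Poly_Mapping.lookup m v) = Poly_Mapping.lookup m l"
    using assms(2) by (subst sum.remove[of UNIV l]) auto
  then show "Poly_Mapping.lookup m v = Poly_Mapping.lookup (Poly_Mapping.single l d) v"
    using assms by (cases "v = l") (auto simp: monomials_of_degree_def lookup_single)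
qed

theorem mainTheorem3:
  fixes d k :: nat
  assumes "CARD('n::finite) \<ge> 3"
    and "d \<ge> 1"
    and "2 \<le> k"
    and "k \<le> (CARD('n) + d - 1) choose (CARD('n) - 1)"
  shows "\<exists>h :: ('n, real) multipoly.
           is_form d h \<and> num_terms h = k \<and> indefinite h \<and> irreducible (complexify h)"
proof -
  obtain I :: "'n set" where "card I = 3" using obtain_subset_with_card_n[OF assms(1)] by auto
  then obtain i j l :: 'n where dist: "i \<noteq> j" "i \<noteq> l" "j \<noteq> l" by (auto simp: card_3_iff)
  define m1 where "m1 = Poly_Mapping.single i 1 + Poly_Mapping.single j (d - 1)"
  define m2 where "m2 = Poly_Mapping.single l d"
  have "Poly_Mapping.lookup m1 i \<noteq> Poly_Mapping.lookup m2 i"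
    using dist by (simp add: m1_def m2_def lookup_add lookup_single)
  then have m12: "m1 \<noteq> m2" by auto
  have mon: "m1 \<in> monomials_of_degree d" "m2 \<in> monomials_of_degree d"
    using \<open>d \<ge> 1\<close>
    by (auto simp: m1_def m2_def monomials_of_degree_def lookup_add sum.distrib sum_lookup_single)
  have "card {m1, m2} \<le> k" "k \<le> card (monomials_of_degree d :: ('n \<Rightarrow>\<^sub>0 nat) set)"
    using assms(3,4) m12 by (auto simp: card_monomials_of_degree)
  then obtain T where T: "{m1, m2} \<subseteq> T" "T \<subseteq> monomials_of_degree d" "card T = k"
    using exists_subset_between[of "{m1, m2}" k "monomials_of_degree d"] mon
    by (auto simp: finite_monomials_of_degree)
  have fin: "finite T" using T(2) finite_monomials_of_degree by (rule finite_subset)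
  \<comment> \<open>At \<open>t = 0\<close> only the binomial remains; for \<open>t > 0\<close> all
    \<open>k\<close> monomials in \<open>T\<close> have nonzero coefficients.\<close>
  define c :: "real \<Rightarrow> ('n \<Rightarrow>\<^sub>0 nat) \<Rightarrow> real"
    where "c t m = (if m = m1 then 1 else if m = m2 then -1 else t)" for t m
  have lookup: "Poly_Mapping.lookup (complexify (poly_on T (c t))) m =
      (if m \<in> T then complex_of_real (c t m) else 0)" for t m
    by (simp add: complexify_def Poly_Mapping.map.rep_eq lookup_poly_on[OF fin] when_def)
  then have keys: "Poly_Mapping.keys (complexify (poly_on T (c t))) = {m \<in> T. c t m \<noteq> 0}" for t
    by (auto simp: in_keys_iff split: if_splits)
  have "\<exists>t>0. irreducible (complexify (poly_on T (c t)))"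
  proof (rule ex_irreducible_perturbation[OF \<open>d \<ge> 1\<close> dist])
    show "is_form d (complexify (poly_on T (c t)))" for t
      using T by (auto simp: is_form_iff_keys keys)
    show "complexify (poly_on T (c t)) \<noteq> 0" for t
      using T(1) keys[of t] by (auto simp: c_def)
    show "((\<lambda>t. Poly_Mapping.lookup (complexify (poly_on T (c t))) m) \<longlongrightarrow>
        Poly_Mapping.lookup (complexify (poly_on T (c 0))) m) (at_right 0)" for m
      unfolding lookup by (auto simp: c_def intro!: tendsto_eq_intros)
    show "Poly_Mapping.keys (complexify (poly_on T (c 0))) =
        {Poly_Mapping.single i 1 + Poly_Mapping.single j (d - 1), Poly_Mapping.single l d}"
      using T(1) m12 unfolding keys m1_def[symmetric] m2_def[symmetric] by (auto simp: c_def)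
  qed
  then obtain t where t: "t > 0" "irreducible (complexify (poly_on T (c t)))" by blast
  define h where "h = poly_on T (c t)"
  have h_keys: "Poly_Mapping.keys h = T" using t(1) by (auto simp: h_def keys_poly_on fin c_def)
  have eval: "eval_poly h x = (\<Sum>m\<in>T. c t m * (\<Prod>v\<in>UNIV. (x $ v) ^ Poly_Mapping.lookup m v))" for x
    unfolding eval_poly_def h_keys by (simp add: h_def lookup_poly_on fin)
  \<comment> \<open>Here \<open>m1\<close> takes the value 1 and \<open>m2\<close>, the only
    monomial with negative coefficient, vanishes.\<close>
  define x :: "real ^ 'n" where "x = (\<chi> v. if v = i \<or> v = j then 1 else 0)"
  have x_m2: "(\<Prod>v\<in>UNIV. (x $ v) ^ Poly_Mapping.lookup m2 v) = 0"
    using dist \<open>d \<ge> 1\<close> by (auto simp: prod_zero_iff m2_def x_def intro!: exI[of _ l])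
  have x_m1: "(\<Prod>v\<in>UNIV. (x $ v) ^ Poly_Mapping.lookup m1 v) = 1"
    by (intro prod.neutral) (auto simp: m1_def x_def lookup_add lookup_single)
  have "c t m1 * (\<Prod>v\<in>UNIV. (x $ v) ^ Poly_Mapping.lookup m1 v) \<le> eval_poly h x"
    unfolding eval
  proof (rule member_le_sum)
    fix m assume "m \<in> T - {m1}"
    then show "0 \<le> c t m * (\<Prod>v\<in>UNIV. (x $ v) ^ Poly_Mapping.lookup m v)"
      proof (cases "m = m2")
      case True
      show ?thesis unfolding True x_m2 by simp
    next
      case False
      then have "0 \<le> c t m" using t(1) by (simp add: c_def)
      then show ?thesis by (intro mult_nonneg_nonneg prod_nonneg) (auto simp: x_def)
    qed
  qed (use T(1) fin in auto)
  then have pos: "eval_poly h x > 0" by (simp add: x_m1 c_def)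
  \<comment> \<open>Among monomials of degree \<open>d\<close> only the pure power \<open>m2\<close>
    survives at this point, so the value is its coefficient -1 whatever \<open>t\<close> is.\<close>
  define y :: "real ^ 'n" where "y = (\<chi> v. if v = l then 1 else 0)"
  have y_m: "(\<Prod>v\<in>UNIV. (y $ v) ^ Poly_Mapping.lookup m v) = 0" if m: "m \<in> T - {m2}" for m
  proof -
    obtain v where "v \<noteq> l" "Poly_Mapping.lookup m v \<noteq> 0"
      using form_monomial_eq_single[of m d l] m T(2) by (auto simp: m2_def)
    then show ?thesis by (auto simp: prod_zero_iff y_def intro!: exI[of _ v])
  qed
  have "(\<Sum>m\<in>T - {m2}. c t m * (\<Prod>v\<in>UNIV. (y $ v) ^ Poly_Mapping.lookup m v)) = 0"
    by (intro sum.neutral ballI) (simp only: y_m mult_zero_right)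
  then have "eval_poly h y = c t m2 * (\<Prod>v\<in>UNIV. (y $ v) ^ Poly_Mapping.lookup m2 v)"
    unfolding eval using T(1) fin by (subst sum.remove[of T m2]) auto
  also have "(\<Prod>v\<in>UNIV. (y $ v) ^ Poly_Mapping.lookup m2 v) = 1"
    by (intro prod.neutral) (auto simp: m2_def y_def lookup_single)
  finally have neg: "eval_poly h y < 0" using m12 by (simp add: c_def)
  have "is_form d h" "num_terms h = k"
    using T by (auto simp: is_form_iff_keys num_terms_def h_keys)
  moreover have "indefinite h" using pos neg by (auto simp: indefinite_def)
  ultimately show ?thesis using t(2) h_def by blast
qed

end
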